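(* The level $k$ quantum $\mathrm{SU}(3)$-invariants of $M^b$, $b\in\mathbb{Z}$, $b\neq0$, are given by $$Z_k(M^b)=\exp(2\pi i/r)\left(-\frac{\sqrt3\,i}{18b}\,r\sum_{n=0}^{3|b|-1}\sum_{m=0}^{3|b|-1}\exp\left(2\pi i r\frac{n^2+m^2-nm}{b}\right)-\frac12\sqrt{\frac{3}{2b}}\,\exp(-\pi i/4)\sqrt r\sum_{n=0}^{2|b|-1}\exp\left(\pi i r\frac{3n^2}{2b}\right)+\frac13+\frac23\exp\left(-2\pi i r\frac b3\right)\right),$$ where $r=k+3$.
   Context: Let $\Sigma=S^1\times S^1$ be the torus, let $t_\mu=\begin{pmatrix}1&-1\\0&1\end{pmatrix}\in\mathrm{SL}(2,\mathbb{Z})\cong\mathrm{MCG}(\Sigma)$ be the left Dehn twist about the meridian $\mu=\{1\}\times S^1$, and let $M^b=T_{t_\mu^b}$, where $T_\phi=(\Sigma\times[0,1])/((x,0)\sim(\phi(x),1))$ denotes the mapping torus of $\phi$. The level $k$ is a non-negative integer, and $Z_k=Z_k^{\mathrm{SU}(N)}$ (here with $N=3$) is the level $k$ quantum $\mathrm{SU}(N)$-invariant (Witten--Reshetikhin--Turaev invariant) of closed oriented $3$-manifolds defined through Blanchet's Homflypt skein theory with $a=\exp(-2\pi i/(2Nr))$, $s=a^{-N}$, $v=s^{-N}$, $r=k+N$. The invariant depends on a choice of $2$-framing of the $3$-manifold; changing the $2$-framing multiplies it by a power of $\exp(2\pi i c/24)$, where $c=k\dim(\mathrm{SU}(N))/(k+N)$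 is the level $k$ central charge, and this ambiguity is largely ignored. For mapping tori $Z_k(T_f)=\mathrm{tr}\,\rho_k(f)$, where $\rho_k$ is the (projective) quantum representation of $\mathrm{MCG}(\Sigma)$ on the vector space with basis indexed by the set $\Gamma_{N,k}$ of Young diagrams $\lambda=(\lambda_1\ge\dots\ge\lambda_{N-1}\ge0)$ with $\lambda_1\le k$. In this basis $\rho_k(t_\mu)$ is diagonal, and $$Z_k^{\mathrm{SU}(N)}(M^b)=\sum_{\lambda\in\Gamma_{N,k}}a^{b\left(-|\lambda|^2+N^2|\lambda|+2N\sum_{(i,j)\in\lambda}(j-i)\right)},$$ where $|\lambda|$ is the number of cells of $\lambda$ and the inner sum runs over its cells $(i,j)$, $1\le j\le\lambda_i$.
   Formalization: Two constants are corrected: the double-sum coefficient is √3 i/(54b) instead of √3 i/(18b), and the prefactor is exp(2πi b/r) instead of exp(2πi/r); as printed, the formula has modulus √7 at k=0, b=1, where Z=1. For b<0 the square root is principal. *)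

theory Defs
  imports "HOL-Analysis.Analysis"
begin

text \<open>
  A Young diagram with at most \<open>N - 1\<close> rows is the list of its \<open>N - 1\<close> row lengths, zeros
  included. Rows and columns of its cells are
  counted from 1.
\<close>

definition young_diagrams :: "nat \<Rightarrow> nat \<Rightarrow> nat list set" where
  "young_diagrams N k =
     {l. length l = N - 1 \<and> sorted_wrt (\<ge>) l \<and> (\<forall>x\<in>set l. x \<le> k)}"

definition cells :: "nat list \<Rightarrow> (nat \<times> nat) set" where
  "cells l = {(i, j). 1 \<le> i \<and> i \<le> length l \<and> 1 \<le> j \<and> j \<le> l ! (i - 1)}"

definition skein_a :: "nat \<Rightarrow> nat \<Rightarrow> complex" where
  "skein_a N k = exp (- (2 * of_real pi * \<i>) / (2 * of_nat N * of_nat (k + N)))"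

definition twist_exponent :: "nat \<Rightarrow> nat list \<Rightarrow> int" where
  "twist_exponent N l =
     - (int (card (cells l)))\<^sup>2 + (int N)\<^sup>2 * int (card (cells l))
     + 2 * int N * (\<Sum>(i, j)\<in>cells l. int j - int i)"

text \<open>
  The matrix of \<open>\<rho>\<^sub>k(t\<^sub>\<mu>\<^sup>b)\<close> on the space with basis \<^term>\<open>young_diagrams N k\<close>. The
  representation is only projective; the lift used here is the one in which a twist acts on
  the basis vector of \<open>\<lambda>\<close> by the framing eigenvalue of the colour \<open>\<lambda>\<close> in the Homflypt skein
  theory, so that the empty diagram has eigenvalue 1.
\<close>

definition twist_rep :: "nat \<Rightarrow> nat \<Rightarrow> int \<Rightarrow> nat list \<Rightarrow> nat list \<Rightarrow> complex" where
  "twist_rep N k b l m =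
     (if l = m then (skein_a N k powi twist_exponent N l) powi b else 0)"

text \<open>
  The level \<open>k\<close> quantum \<open>SU(N)\<close> invariant of \<open>M\<^sup>b\<close>, the mapping torus of \<open>t\<^sub>\<mu>\<^sup>b\<close>, for the
  choice of 2-framing determined by that lift: the trace of \<open>\<rho>\<^sub>k(t\<^sub>\<mu>\<^sup>b)\<close>.
\<close>

definition Z_twist_torus :: "nat \<Rightarrow> nat \<Rightarrow> int \<Rightarrow> complex" where
  "Z_twist_torus N k b = (\<Sum>l\<in>young_diagrams N k. twist_rep N k b l l)"

lemma finite_young_diagrams: "finite (young_diagrams N k)"
proof (rule finite_subset)
  show "young_diagrams N k \<subseteq> {l. set l \<subseteq> {..k} \<and> length l = N - 1}"
    by (auto simp: young_diagrams_def)
  show "finite {l. set l \<subseteq> {..k} \<and> length l = N - 1}"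
    by (rule finite_lists_length_eq) simp
qed

lemma finite_cells: "finite (cells l)"
proof (rule finite_subset)
  show "cells l \<subseteq> (SIGMA i:{..length l}. {..l ! (i - 1)})"
    by (auto simp: cells_def)
qed auto

lemma Z_twist_torus_eq:
  "Z_twist_torus N k b =
     (\<Sum>l\<in>young_diagrams N k. skein_a N k powi (b * twist_exponent N l))"
  unfolding Z_twist_torus_def
  by (rule sum.cong) (simp_all add: twist_rep_def mult.commute[of b] power_int_mult)

text \<open>
  In the literature the closed form of the \<open>SU(3)\<close> invariant also appears with prefactor
  \<open>exp (2 \<pi> \<i> / r)\<close> and coefficient \<open>18 b\<close> in front of the double sum. With the invariant as
  defined here these must read \<open>exp (2 \<pi> \<i> b / r)\<close> and \<open>54 b\<close>: at level 0 with \<open>b = 1\<close> the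
  invariant is 1, while the other form has modulus \<open>sqrt 7\<close>, so that no change of
  2-framing reconciles the two. For \<open>b < 0\<close> the square root of \<open>3 / (2 b)\<close> is the principal
  complex one.
\<close>

end

theory Submission
  imports Defs
begin

text \<open>
  Put \<open>p = \<lambda>\<^sub>1 - \<lambda>\<^sub>2 + 1\<close>, \<open>q = \<lambda>\<^sub>2 + 1\<close> and \<open>Q p q = p\<^sup>2 + p q + q\<^sup>2\<close>. The twist exponent of
  \<open>\<lambda>\<close> is \<open>2 Q p q - 6\<close>, so up to the factor \<open>exp (2 \<pi> \<i> b / r)\<close> the invariant is the sum of
  \<open>exp (- 2 \<pi> \<i> b Q p q / (3 r))\<close> over the lattice points in the open triangle
  \<open>p, q > 0\<close>, \<open>p + q < r\<close>. This triangle is an alcove of the affine Weyl group of type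
  \<open>A\<^sub>2\<close>, scaled by \<open>r\<close>, and the summand is invariant under that group. A fundamental domain
  for its translations consists of six alcoves, so six times the alcove sum is a complete
  quadratic Gauss sum in two variables with the reflection lines removed: the points inside the
  walls give a complete Gauss sum in one variable, and the three vertices give the terms
  \<open>1 / 3 + 2 / 3 exp (- 2 \<pi> \<i> r b / 3)\<close> (\<open>sum_alcove_unfold\<close>).

  It remains to exchange the roles of \<open>b\<close> and \<open>r\<close>, which is quadratic reciprocity for Gauss
  sums with a linear term, in one variable for the walls (\<open>gauss_sum_reciprocity\<close>) and, by
  using it in each variable in turn, in two variables (\<open>double_gauss_sum_reciprocity\<close>).
  Reciprocity itself is Poisson summation on the cyclic group of order \<open>N = a c\<close>: the Fourier
  transform of \<open>x \<mapsto> exp (\<pi> \<i> x\<^sup>2 / N)\<close> is its complex conjugate times the Gauss sum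
  \<open>G N\<close>, and the subgroups generated by \<open>a\<close> and by \<open>c\<close> annihilate each other
  (\<open>gauss_sum_poisson\<close>).

  The constant, \<open>G N = exp (\<pi> \<i> / 4) sqrt N\<close> for even \<open>N\<close> (\<open>gauss_sum_eq\<close>), is the only
  analytic part. The same Poisson summation with \<open>a = m\<close> and \<open>c = N m\<close> shows that
  \<open>G N / sqrt N\<close> does not change when \<open>N\<close> is multiplied by a square. On the other
  hand \<open>G N / sqrt N\<close> is a Riemann sum of the Fresnel integral, and hence is almost the same
  for two large moduli that are close to each other. Comparing a large modulus \<open>N j\<^sup>8\<close> with a
  nearby \<open>2 m\<^sup>2\<close> gives \<open>G N / sqrt N = G 2 / sqrt 2\<close>, and \<open>G 2 = 1 + \<i>\<close>.
\<close>

section \<open>Phases and sums of periodic functions\<close>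

definition phase :: "real \<Rightarrow> complex" where
  "phase x = cis (pi * x)"

lemma phase_0 [simp]: "phase 0 = 1"
  by (simp add: phase_def)

lemma norm_phase [simp]: "norm (phase x) = 1"
  by (simp add: phase_def)

lemma phase_add: "phase (x + y) = phase x * phase y"
  by (simp add: phase_def distrib_left cis_mult)

lemma phase_even_int: "phase (2 * of_int n) = 1"
  using cis_multiple_2pi[of "of_int n"] by (simp add: phase_def mult.assoc mult.left_commute)

lemma phase_cong:
  assumes "x = y + 2 * of_int n"
  shows "phase x = phase y"
  using assms by (simp add: phase_add phase_even_int)

lemma phase_eq_1_iff: "phase x = 1 \<longleftrightarrow> (\<exists>n. x = 2 * of_int n)"
proof
  assume "phase x = 1"
  then have "cos (pi * x) = 1"
    by (simp add: phase_def complex_eq_iff)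
  then obtain n :: int where "pi * x = of_int n * 2 * pi"
    by (auto simp: cos_one_2pi_int)
  then have "x = 2 * of_int n" by simp
  then show "\<exists>n. x = 2 * of_int n" by blast
qed (auto simp: phase_even_int)

lemma cnj_phase: "cnj (phase x) = phase (- x)"
  by (simp add: phase_def cis_cnj)

lemma norm_cis_minus_one_le: "norm (cis t - 1) \<le> \<bar>t\<bar>"
proof -
  have "norm (cis t - 1) ^ 2 = (cos t - 1) ^ 2 + sin t ^ 2"
    by (simp add: cmod_power2)
  also have "\<dots> = 2 - 2 * cos t"
    using sin_cos_squared_add[of t] by (simp add: power2_eq_square algebra_simps)
  also have "\<dots> = (2 * \<bar>sin (t / 2)\<bar>) ^ 2"
    using cos_double_sin[of "t / 2"] by (simp add: power_mult_distrib)
  also have "\<dots> \<le> \<bar>t\<bar> ^ 2"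
    using abs_sin_x_le_abs_x[of "t / 2"] by (intro power_mono) auto
  finally show ?thesis by (rule power2_le_imp_le) simp
qed

lemma norm_phase_diff_le: "norm (phase x - phase y) \<le> pi * \<bar>x - y\<bar>"
proof -
  have "phase x - phase y = phase y * (cis (pi * (x - y)) - 1)"
    using phase_add[of y "x - y"] by (simp add: phase_def algebra_simps)
  then have "norm (phase x - phase y) = norm (cis (pi * (x - y)) - 1)"
    by (simp add: norm_mult)
  also have "\<dots> \<le> \<bar>pi * (x - y)\<bar>"
    by (rule norm_cis_minus_one_le)
  finally show ?thesis by (simp add: abs_mult)
qed

lemma sum_periodic_shift:
  fixes g :: "int \<Rightarrow> 'a::ab_group_add"
  assumes per: "\<And>x. g (x + N) = g x" and "0 < N"
  shows "(\<Sum>x\<in>{0..<N}. g (x + y)) = (\<Sum>x\<in>{0..<N}. g x)"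
proof -
  have step: "(\<Sum>x\<in>{0..<N}. g (x + (y + 1))) = (\<Sum>x\<in>{0..<N}. g (x + y))" for y
  proof -
    have "(\<Sum>x\<in>{0..<N}. g (x + (y + 1))) = (\<Sum>x\<in>{1..<N+1}. g (x + y))"
      by (rule sum.reindex_bij_witness[of _ "\<lambda>x. x - 1" "\<lambda>x. x + 1"]) (auto simp: algebra_simps)
    also have "{1..<N+1} = insert N {1..<N}" using \<open>0 < N\<close> by auto
    also have "(\<Sum>x\<in>\<dots>. g (x + y)) = g y + (\<Sum>x\<in>{1..<N}. g (x + y))"
      using per[of y] by (simp add: add.commute)
    also have "\<dots> = (\<Sum>x\<in>insert 0 {1..<N}. g (x + y))" by simp
    also have "insert 0 {1..<N} = {0..<N}" using \<open>0 < N\<close> by auto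
    finally show ?thesis .
  qed
  show ?thesis
  proof (induction y rule: int_induct[where k = 0])
    case (step2 i)
    then show ?case using step[of "i - 1"] by simp
  qed (use step in auto)
qed

lemma int_div_less_iff:
  fixes x N m :: int
  assumes "0 < N"
  shows "x div N < m \<longleftrightarrow> x < m * N"
proof
  assume "x div N < m"
  then have "(x div N + 1) * N \<le> m * N" using assms by (intro mult_right_mono) auto
  then show "x < m * N" using pos_mod_bound[OF assms, of x] div_mult_mod_eq[of x N]
    unfolding distrib_right by linarith
next
  assume "x < m * N"
  then have "x div N * N < m * N" using pos_mod_sign[OF assms, of x] div_mult_mod_eq[of x N]
    by linarith
  then show "x div N < m" using assms by simp
qed

lemma sum_atLeastLessThan_times:
  fixes g :: "int \<Rightarrow> 'a::comm_monoid_add"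
  assumes "0 < N" "0 < m"
  shows "(\<Sum>x\<in>{0..<m * N}. g x) = (\<Sum>i\<in>{0..<m}. \<Sum>x\<in>{0..<N}. g (x + i * N))"
proof -
  have "(\<Sum>i\<in>{0..<m}. \<Sum>x\<in>{0..<N}. g (x + i * N)) = (\<Sum>(i, x)\<in>{0..<m} \<times> {0..<N}. g (x + i * N))"
    by (simp add: sum.cartesian_product)
  also have "\<dots> = (\<Sum>x\<in>{0..<m * N}. g x)"
  proof (rule sum.reindex_bij_witness[of _ "\<lambda>x. (x div N, x mod N)" "\<lambda>(i, x). x + i * N"])
    fix a assume "a \<in> {0..<m} \<times> {0..<N}"
    then obtain i x where a: "a = (i, x)" "0 \<le> i" "i \<le> m - 1" "0 \<le> x" "x < N" by auto
    have "i * N \<le> (m - 1) * N" using a assms by (intro mult_right_mono) auto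
    then have "x + i * N < m * N" using a by (simp add: algebra_simps)
    then show "(case a of (i, x) \<Rightarrow> x + i * N) \<in> {0..<m * N}" using a assms by simp
  next
    fix x assume "x \<in> {0..<m * N}"
    then have x: "0 \<le> x" "x < m * N" by auto
    have "x div N < m" using x assms by (simp add: int_div_less_iff)
    then show "(x div N, x mod N) \<in> {0..<m} \<times> {0..<N}"
      using x assms by (simp add: pos_imp_zdiv_nonneg_iff)
  qed (use assms in auto)
  finally show ?thesis ..
qed

lemma sum_periodic_times:
  fixes g :: "int \<Rightarrow> 'a::comm_ring_1"
  assumes per: "\<And>x. g (x + N) = g x" and "0 < N" "0 < m"
  shows "(\<Sum>x\<in>{0..<m * N}. g x) = of_int m * (\<Sum>x\<in>{0..<N}. g x)"
proof -
  have "(\<Sum>x\<in>{0..<m * N}. g x) = (\<Sum>i\<in>{0..<m}. \<Sum>x\<in>{0..<N}. g (x + i * N))"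
    by (rule sum_atLeastLessThan_times) fact+
  also have "\<dots> = (\<Sum>i\<in>{0..<m}. \<Sum>x\<in>{0..<N}. g x)"
    by (intro sum.cong refl sum_periodic_shift) (use assms in auto)
  finally show ?thesis using \<open>0 < m\<close> by simp
qed

text \<open>
  Shifting the index by one multiplies the sum by \<open>phase (2 x / a)\<close>, so the sum vanishes unless
  this factor is 1.
\<close>

lemma sum_phase_character:
  assumes "0 < a"
  shows "(\<Sum>j\<in>{0..<a}. phase (2 * of_int x * of_int j / of_int a)) =
    (if a dvd x then of_int a else 0)"
proof (cases "a dvd x")
  case True
  then obtain c where "x = a * c" by blast
  then have "phase (2 * of_int x * of_int j / of_int a) = 1" for j
    using phase_even_int[of "c * j"] \<open>0 < a\<close> by (simp add: mult.assoc)
  then show ?thesis using True \<open>0 < a\<close> by simp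
next
  case False
  define S where "S = (\<Sum>j\<in>{0..<a}. phase (2 * of_int x * of_int j / of_int a))"
  define w where "w = phase (2 * of_int x / of_int a)"
  have "S = (\<Sum>j\<in>{0..<a}. phase (2 * of_int x * of_int (j + 1) / of_int a))"
    unfolding S_def
  proof (rule sum_periodic_shift[symmetric, where g = "\<lambda>j. phase (2 * of_int x * of_int j / of_int a)"])
    show "phase (2 * of_int x * of_int (j + a) / of_int a) =
        phase (2 * of_int x * of_int j / of_int a)" for j
      by (rule phase_cong[of _ _ x]) (use \<open>0 < a\<close> in \<open>simp add: field_simps\<close>)
  qed fact
  also have "\<dots> = w * S"
    unfolding S_def w_def sum_distrib_left
    by (intro sum.cong refl) (simp add: phase_add[symmetric] field_simps)
  finally have "S = 0 \<or> w = 1" by simp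
  moreover have "w \<noteq> 1"
  proof
    assume "w = 1"
    then obtain n :: int where "2 * real_of_int x / of_int a = 2 * of_int n"
      by (auto simp: w_def phase_eq_1_iff)
    then have "real_of_int x = of_int (a * n)" using \<open>0 < a\<close> by (simp add: field_simps)
    then have "x = a * n" by (simp only: of_int_eq_iff)
    then show False using False by simp
  qed
  ultimately show ?thesis using False by (simp add: S_def)
qed

section \<open>Poisson summation for quadratic Gauss sums\<close>

text \<open>
  The exponent is \<open>\<pi> \<i> x\<^sup>2 / N\<close>, half of the one in the classical Gauss sum, so the
  summand is periodic modulo \<open>N\<close> only for even \<open>N\<close>.
\<close>

definition gauss_sum :: "int \<Rightarrow> complex" where
  "gauss_sum N = (\<Sum>x\<in>{0..<N}. phase (of_int x ^ 2 / of_int N))"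

lemma phase_square_periodic:
  assumes "even N" "0 < N"
  shows "phase (of_int (x + N) ^ 2 / of_int N) = phase (of_int x ^ 2 / of_int N)"
proof -
  obtain M where "N = 2 * M" using \<open>even N\<close> by blast
  then show ?thesis
    by (intro phase_cong[of _ _ "x + M"]) (use assms in \<open>simp add: field_simps power2_eq_square\<close>)
qed

text \<open>
  Completing the square: \<open>x\<^sup>2 + 2 x y = (x + y)\<^sup>2 - y\<^sup>2\<close>, and the shift by \<open>y\<close> does not
  change a sum over a full period.
\<close>

lemma gauss_sum_fourier:
  assumes "even N" "0 < N"
  shows "(\<Sum>x\<in>{0..<N}. phase (of_int x ^ 2 / of_int N) * phase (2 * of_int x * of_int y / of_int N)) =
    gauss_sum N * phase (- (of_int y ^ 2 / of_int N))"
proof -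
  have "phase (of_int x ^ 2 / of_int N) * phase (2 * of_int x * of_int y / of_int N) =
      phase (of_int (x + y) ^ 2 / of_int N) * phase (- (of_int y ^ 2 / of_int N))" for x
    using assms by (simp add: phase_add[symmetric] add_divide_distrib diff_divide_distrib
        power2_eq_square algebra_simps)
  then have "(\<Sum>x\<in>{0..<N}. phase (of_int x ^ 2 / of_int N) * phase (2 * of_int x * of_int y / of_int N)) =
      (\<Sum>x\<in>{0..<N}. phase (of_int (x + y) ^ 2 / of_int N)) * phase (- (of_int y ^ 2 / of_int N))"
    by (simp add: sum_distrib_right)
  also have "(\<Sum>x\<in>{0..<N}. phase (of_int (x + y) ^ 2 / of_int N)) = gauss_sum N"
    unfolding gauss_sum_def
    by (rule sum_periodic_shift) (use assms phase_square_periodic in auto)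
  finally show ?thesis .
qed

text \<open>
  Sum the Fourier transform of \<open>gauss_sum_fourier\<close> over the coset \<open>h + c \<int>\<close> modulo
  \<open>a c\<close>. By orthogonality of characters only the multiples \<open>x = a n\<close> survive on the other
  side.
\<close>

lemma gauss_sum_poisson:
  assumes "0 < a" "0 < c" "even (a * c)"
  shows "of_int a * (\<Sum>n\<in>{0..<c}. phase ((of_int a * of_int n ^ 2 + 2 * of_int h * of_int n) / of_int c)) =
    gauss_sum (a * c) * (\<Sum>j\<in>{0..<a}. phase (- (of_int (c * j + h) ^ 2 / of_int (a * c))))"
proof -
  define N where "N = a * c"
  have N: "0 < N" "even N" using assms by (auto simp: N_def)
  define g where "g x = phase (of_int x ^ 2 / of_int N) * phase (2 * of_int x * of_int h / of_int N)" for x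
  have "gauss_sum N * (\<Sum>j\<in>{0..<a}. phase (- (of_int (c * j + h) ^ 2 / of_int N))) =
      (\<Sum>j\<in>{0..<a}. \<Sum>x\<in>{0..<N}. phase (of_int x ^ 2 / of_int N) *
         phase (2 * of_int x * of_int (c * j + h) / of_int N))"
    by (simp only: gauss_sum_fourier[OF N(2,1)] sum_distrib_left)
  also have "\<dots> = (\<Sum>x\<in>{0..<N}. g x * (\<Sum>j\<in>{0..<a}. phase (2 * of_int x * of_int j / of_int a)))"
  proof (subst sum.swap, unfold sum_distrib_left, intro sum.cong refl)
    fix x j
    have "2 * of_int x * of_int (c * j + h) / real_of_int N =
        2 * of_int x * of_int h / of_int N + 2 * of_int x * of_int j / of_int a"
      using assms by (simp add: N_def field_simps)
    then show "phase (of_int x ^ 2 / of_int N) * phase (2 * of_int x * of_int (c * j + h) / of_int N) =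
        g x * phase (2 * of_int x * of_int j / of_int a)"
      by (simp add: g_def phase_add mult.assoc)
  qed
  also have "\<dots> = (\<Sum>x\<in>{0..<N}. if a dvd x then of_int a * g x else 0)"
    by (intro sum.cong refl) (simp add: sum_phase_character[OF \<open>0 < a\<close>])
  also have "\<dots> = (\<Sum>x\<in>{x\<in>{0..<N}. a dvd x}. of_int a * g x)"
    by (rule sum.inter_filter[symmetric]) simp
  also have "\<dots> = (\<Sum>n\<in>{0..<c}. of_int a * g (a * n))"
    by (rule sum.reindex_bij_witness[of _ "\<lambda>n. a * n" "\<lambda>x. x div a"])
      (use assms in \<open>auto simp: N_def pos_imp_zdiv_nonneg_iff int_div_less_iff mult.commute\<close>)
  also have "\<dots> = (\<Sum>n\<in>{0..<c}. of_int a *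
      phase ((of_int a * of_int n ^ 2 + 2 * of_int h * of_int n) / of_int c))"
    using assms by (simp add: g_def N_def phase_add[symmetric] field_simps power2_eq_square)
  finally show ?thesis by (simp add: N_def sum_distrib_left)
qed

text \<open>
  In \<open>gauss_sum_poisson\<close> with \<open>a = m\<close>, \<open>c = m N\<close> and \<open>h = 0\<close> every term of the right-hand
  sum is 1, because \<open>N\<close> is even. Thus \<open>gauss_sum N / sqrt N\<close> depends only on the class of
  \<open>N\<close> modulo squares.
\<close>

lemma gauss_sum_times_square:
  assumes "even N" "0 < N" "0 < m"
  shows "gauss_sum (m ^ 2 * N) = of_int m * gauss_sum N"
proof -
  have "of_int m * (\<Sum>n\<in>{0..<m * N}. phase (of_int n ^ 2 / of_int N)) =
      gauss_sum (m ^ 2 * N) * (\<Sum>j\<in>{0..<m}. phase (- (of_int (N * j ^ 2))))"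
    using gauss_sum_poisson[of m "m * N" 0] assms
    by (simp add: power2_eq_square mult_ac)
  also have "(\<Sum>j\<in>{0..<m}. phase (- (of_int (N * j ^ 2)))) = of_int m"
  proof -
    obtain M where "N = 2 * M" using \<open>even N\<close> by blast
    then have "phase (- (of_int (N * j ^ 2))) = 1" for j
      using phase_even_int[of "- M * j ^ 2"] by (simp add: mult.assoc)
    then show ?thesis using \<open>0 < m\<close> by simp
  qed
  also have "(\<Sum>n\<in>{0..<m * N}. phase (of_int n ^ 2 / of_int N)) = of_int m * gauss_sum N"
    unfolding gauss_sum_def
    by (rule sum_periodic_times) (use assms phase_square_periodic in auto)
  finally show ?thesis using \<open>0 < m\<close> by (simp add: mult_ac)
qed

section \<open>The value of the quadratic Gauss sum\<close>

text \<open>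
  The factor \<open>w = - 1 / 2 - \<i> / 2 cot t\<close> is \<open>1 / (cis (2 t) - 1)\<close>, written so that its variation
  is visibly that of the cotangent.
\<close>

lemma summation_weight:
  assumes "sin t \<noteq> 0"
  shows "(- (1 / 2) - \<i> / 2 * of_real (cot t)) * (cis (2 * t) - 1) = 1"
proof -
  have "cis (2 * t) = Complex (1 - 2 * sin t ^ 2) (2 * sin t * cos t)"
    by (simp add: complex_eq_iff cos_double_sin sin_double)
  moreover have "sin t * sin t + cos t * cos t = 1"
    using sin_cos_squared_add[of t] by (simp add: power2_eq_square)
  ultimately show ?thesis
    using assms by (simp add: complex_eq_iff cot_def power2_eq_square)
qed

lemma cot_antimono:
  assumes "0 < s" "s \<le> t" "t < pi"
  shows "cot t \<le> (cot s :: real)"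
proof -
  have "0 < sin s" "0 < sin t" "0 \<le> sin (t - s)"
    using assms by (auto intro!: sin_gt_zero sin_ge_zero)
  then show ?thesis
    by (simp add: cot_def sin_diff field_simps)
qed

lemma cot_le_inverse:
  assumes "0 < t" "t \<le> pi / 2"
  shows "cot t \<le> 1 / (t::real)"
proof (cases "t = pi / 2")
  case True
  then show ?thesis unfolding True by (simp add: cot_def)
next
  case False
  then have "t \<le> tan t" using assms abs_tan_ge[of t] tan_gt_zero[of t] by auto
  then show ?thesis using assms
    by (simp add: cot_altdef field_simps)
qed

lemma cot_nonneg: "0 < t \<Longrightarrow> t \<le> pi / 2 \<Longrightarrow> 0 \<le> cot (t::real)"
  by (auto simp: cot_def intro!: divide_nonneg_nonneg cos_ge_zero sin_ge_zero)

text \<open>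
  Summation by parts, as in the Kuzmin--Landau inequality. With \<open>z x = phase (x\<^sup>2 / N)\<close> the ratio
  \<open>z (x + 1) / z x\<close> is \<open>cis (2 t x)\<close> with \<open>t\<close> increasing and at most \<open>\<pi> / 2\<close> on this range,
  so \<open>z x = w x (z (x + 1) - z x)\<close> telescopes up to the total variation of the weights \<open>w\<close>,
  which is a difference of two cotangents.
\<close>

lemma gauss_tail_bound:
  fixes X N :: nat
  assumes "1 \<le> X" "even N" "Y \<ge> X" "2 * Y + 1 \<le> N"
  shows "norm (\<Sum>x\<in>{X..Y}. phase (real x ^ 2 / real N)) \<le> 1 + real N / real X"
proof -
  define t where "t x = pi * (2 * real x + 1) / (2 * real N)" for x
  define z where "z x = phase (real x ^ 2 / real N)" for x
  define w where "w x = - (1 / 2) - \<i> / 2 * complex_of_real (cot (t x))" for x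
  have N: "0 < real N" using assms by simp
  have t: "0 < t x" "t x \<le> pi / 2" "t x < pi" if "x \<le> Y" for x
  proof -
    have "2 * real x + 1 \<le> real N" using that assms by linarith
    then have "pi * (2 * real x + 1) \<le> pi * real N" by (intro mult_left_mono) auto
    then show *: "t x \<le> pi / 2" using N by (simp add: t_def field_simps)
    show "0 < t x" using N by (simp add: t_def)
    show "t x < pi" using * pi_gt_zero by linarith
  qed
  have telescope: "z x = w x * z (Suc x) - w x * z x" if "x \<le> Y" for x
  proof -
    have "z (Suc x) = z x * cis (2 * t x)"
    proof -
      have "real (Suc x) ^ 2 / real N = real x ^ 2 / real N + (2 * real x + 1) / real N"
        by (simp add: add_divide_distrib[symmetric] power2_eq_square algebra_simps)
      then have "z (Suc x) = z x * phase ((2 * real x + 1) / real N)"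
        unfolding z_def by (simp only: phase_add)
      also have "phase ((2 * real x + 1) / real N) = cis (2 * t x)"
        using N by (simp add: phase_def t_def)
      finally show ?thesis .
    qed
    moreover have "sin (t x) \<noteq> 0" using sin_gt_zero[of "t x"] t[OF that] by simp
    then have "w x * (cis (2 * t x) - 1) = 1"
      unfolding w_def by (rule summation_weight)
    then have "z x = z x * (w x * (cis (2 * t x) - 1))" by simp
    ultimately show ?thesis by (simp add: algebra_simps)
  qed
  have cot0: "0 \<le> cot (t x)" if "x \<le> Y" for x
    using t[OF that] by (intro cot_nonneg) auto
  have norm_w: "norm (w x) \<le> 1 / 2 + cot (t x) / 2" if "x \<le> Y" for x
    using cot0[OF that] norm_triangle_ineq4[of "- (1 / 2)" "\<i> / 2 * complex_of_real (cot (t x))"]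
    by (simp add: w_def norm_mult norm_divide)
  have norm_z: "norm (z x) = 1" for x by (simp add: z_def)
  \<comment> \<open>The error left after telescoping; it grows only by the variation of \<open>w\<close>.\<close>
  define err where "err Z = (\<Sum>x\<in>{X..Z}. z x) - w Z * z (Suc Z) + w X * z X" for Z
  have "norm (err Z) \<le> (cot (t X) - cot (t Z)) / 2" if "X \<le> Z" "Z \<le> Y" for Z
    using that
  proof (induction Z rule: dec_induct)
    case base
    then show ?case using telescope[of X] by (simp add: err_def algebra_simps)
  next
    case (step Z)
    have "err (Suc Z) = err Z + (w Z - w (Suc Z)) * z (Suc Z)"
      using step.hyps telescope[of "Suc Z"] step.prems by (simp add: err_def algebra_simps)
    then have "norm (err (Suc Z)) \<le> norm (err Z) + norm (w Z - w (Suc Z))"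
      using norm_triangle_ineq[of "err Z" "(w Z - w (Suc Z)) * z (Suc Z)"]
      by (simp only: norm_mult norm_z mult_1_right)
    moreover have "norm (w Z - w (Suc Z)) = (cot (t Z) - cot (t (Suc Z))) / 2"
    proof -
      have "w Z - w (Suc Z) = - (\<i> / 2) * complex_of_real (cot (t Z) - cot (t (Suc Z)))"
        by (simp add: w_def algebra_simps)
      moreover have "t Z \<le> t (Suc Z)" using N by (simp add: t_def divide_right_mono)
      then have "cot (t (Suc Z)) \<le> cot (t Z)"
        using t[of Z] t[of "Suc Z"] step.prems by (intro cot_antimono) auto
      ultimately show ?thesis by (simp only: norm_mult norm_of_real) simp
    qed
    ultimately show ?case using step.IH step.prems by (simp add: field_simps)
  qed
  then have main: "norm (err Y) \<le> (cot (t X) - cot (t Y)) / 2" using assms by simp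
  have "norm (\<Sum>x\<in>{X..Y}. z x) = norm (err Y + (w Y * z (Suc Y) - w X * z X))"
    by (simp add: err_def)
  also have "\<dots> \<le> (cot (t X) - cot (t Y)) / 2 + (norm (w Y) + norm (w X))"
    by (intro norm_triangle_mono main order_trans[OF norm_triangle_ineq4])
      (simp add: norm_mult norm_z)
  also have "\<dots> \<le> 1 + cot (t X)"
    using norm_w[of X] norm_w[of Y] assms by (simp add: field_simps)
  also have "cot (t X) \<le> 1 / t X"
    using t[of X] assms by (intro cot_le_inverse) auto
  also have "1 / t X \<le> real N / real X"
  proof -
    have "2 * real X \<le> pi * (2 * real X + 1)"
      using pi_ge_two mult_mono[of 1 pi "2 * real X" "2 * real X + 1"] by simp
    then have "2 * real N / (pi * (2 * real X + 1)) \<le> 2 * real N / (2 * real X)"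
      using assms by (intro divide_left_mono mult_pos_pos) auto
    then show ?thesis by (simp add: t_def)
  qed
  finally show ?thesis by (simp add: z_def)
qed

text \<open>
  The summand is symmetric under \<open>x \<mapsto> 2 M - x\<close>, so the Gauss sum is twice its first half up to
  the two end terms; the tail bound then allows cutting that half at \<open>X\<close>. For \<open>X\<close> much larger
  than \<open>sqrt M\<close> the error is small compared to \<open>sqrt M\<close>.
\<close>

lemma gauss_sum_head_bound:
  fixes X M :: nat
  assumes "1 \<le> X" "X < M"
  shows "norm (gauss_sum (int (2 * M)) - 2 * (\<Sum>x<X. phase (real x ^ 2 / real (2 * M))))
     \<le> 4 + 2 * real (2 * M) / real X"
proof -
  define z where "z x = phase (real x ^ 2 / real (2 * M))" for x
  have M: "0 < M" using assms by simp
  have "gauss_sum (int (2 * M)) = (\<Sum>x<2 * M. z x)"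
    unfolding gauss_sum_def z_def
    by (rule sum.reindex_bij_witness[of _ int nat]) auto
  also have "{..<2 * M} = {..<M} \<union> ({M} \<union> {M<..<2*M})" using M by auto
  also have "(\<Sum>x\<in>\<dots>. z x) = (\<Sum>x<M. z x) + (z M + (\<Sum>x\<in>{M<..<2*M}. z x))"
    by (subst sum.union_disjoint; (subst sum.union_disjoint)?; force)
  also have "(\<Sum>x\<in>{M<..<2*M}. z x) = (\<Sum>x\<in>{1..<M}. z x)"
  proof (rule sum.reindex_bij_witness[of _ "\<lambda>x. 2 * M - x" "\<lambda>x. 2 * M - x"])
    fix x assume x: "x \<in> {M<..<2*M}"
    then have "real (2 * M - x) = 2 * real M - real x" by (simp add: of_nat_diff)
    then show "z (2 * M - x) = z x"
      unfolding z_def using M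
      by (intro phase_cong[of _ _ "int M - int x"]) (simp add: field_simps power2_eq_square)
  qed auto
  also have "(\<Sum>x\<in>{1..<M}. z x) = (\<Sum>x<M. z x) - z 0"
    using M by (simp add: lessThan_atLeast0 sum.atLeast_Suc_lessThan)
  also have "(\<Sum>x<M. z x) = (\<Sum>x<X. z x) + (\<Sum>x\<in>{X..M - 1}. z x)"
  proof -
    have "{..<M} = {..<X} \<union> {X..M - 1}" using assms by auto
    then show ?thesis by (simp add: sum.union_disjoint ivl_disj_int)
  qed
  finally have "gauss_sum (int (2 * M)) - 2 * (\<Sum>x<X. z x) =
      2 * (\<Sum>x\<in>{X..M - 1}. z x) + (z M - z 0)"
    by (simp add: algebra_simps)
  also have "norm \<dots> \<le> 2 * (1 + real (2 * M) / real X) + 2"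
  proof (intro norm_triangle_mono)
    show "norm (2 * (\<Sum>x\<in>{X..M - 1}. z x)) \<le> 2 * (1 + real (2 * M) / real X)"
      using gauss_tail_bound[of X "2 * M" "M - 1"] assms unfolding z_def norm_mult
      by (intro mult_mono) auto
    show "norm (z M - z 0) \<le> 2"
      using norm_triangle_ineq4[of "z M" "z 0"] by (simp add: z_def)
  qed
  finally show ?thesis by (simp add: z_def)
qed


text \<open>
  For \<open>x < X\<close> the phases \<open>x\<^sup>2 / u\<^sup>2\<close> and \<open>x\<^sup>2 / v\<^sup>2\<close> differ by at most
  \<open>16 X\<^sup>2 / u\<^sup>3\<close>, and there are \<open>X\<close> of them; the second term accounts for the
  different normalisations.
\<close>

lemma gauss_head_diff:
  fixes u v :: real and X :: nat
  assumes "0 < v" "v \<le> u" "u \<le> v + 2" "u \<le> 2 * v"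
  shows "norm ((\<Sum>x<X. phase (real x ^ 2 / u ^ 2)) / of_real u -
               (\<Sum>x<X. phase (real x ^ 2 / v ^ 2)) / of_real v)
     \<le> 16 * pi * real X ^ 3 / u ^ 4 + 4 * real X / u ^ 2"
proof -
  have u: "0 < u" using assms by simp
  define A where "A = (\<Sum>x<X. phase (real x ^ 2 / u ^ 2))"
  define A' where "A' = (\<Sum>x<X. phase (real x ^ 2 / v ^ 2))"
  have uv: "u - v \<le> 2" "0 \<le> u - v" using assms by auto
  have inv: "1 / v - 1 / u \<le> 4 / u ^ 2"
  proof -
    have "1 / v - 1 / u = (u - v) / (u * v)" using assms u by (simp add: field_simps)
    also have "\<dots> \<le> 2 / (u * v)" using assms u by (intro divide_right_mono) auto
    also have "\<dots> \<le> 2 / (u * (u / 2))" using assms u by (intro divide_left_mono mult_left_mono) auto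
    finally show ?thesis by (simp add: power2_eq_square)
  qed
  have inv0: "1 / u \<le> 1 / v" using assms by (intro divide_left_mono) auto
  have inv2: "1 / v ^ 2 - 1 / u ^ 2 \<le> 16 / u ^ 3"
  proof -
    have "1 / v ^ 2 - 1 / u ^ 2 = (1 / v - 1 / u) * (1 / v + 1 / u)"
      by (simp add: algebra_simps power2_eq_square)
    also have "\<dots> \<le> 4 / u ^ 2 * (2 / u + 2 / u)"
    proof (intro mult_mono inv add_mono)
      show "1 / v \<le> 2 / u" using assms u by (simp add: field_simps)
    qed (use assms u in \<open>auto simp: divide_simps\<close>)
    finally show ?thesis using u by (simp add: power2_eq_square power3_eq_cube)
  qed
  have inv20: "1 / u ^ 2 \<le> 1 / v ^ 2" using assms u by (intro divide_left_mono power_mono) auto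
  have "norm (A - A') \<le> (\<Sum>x<X. norm (phase (real x ^ 2 / u ^ 2) - phase (real x ^ 2 / v ^ 2)))"
    unfolding A_def A'_def sum_subtractf[symmetric] by (rule norm_sum)
  also have "\<dots> \<le> (\<Sum>x<X. pi * (real X ^ 2 * (16 / u ^ 3)))"
  proof (rule sum_mono)
    fix x assume "x \<in> {..<X}"
    then have "real x ^ 2 \<le> real X ^ 2" by (intro power_mono) auto
    have "norm (phase (real x ^ 2 / u ^ 2) - phase (real x ^ 2 / v ^ 2)) \<le>
        pi * \<bar>real x ^ 2 / u ^ 2 - real x ^ 2 / v ^ 2\<bar>" by (rule norm_phase_diff_le)
    also have "real x ^ 2 / u ^ 2 - real x ^ 2 / v ^ 2 = - (real x ^ 2 * (1 / v ^ 2 - 1 / u ^ 2))"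
      by (simp add: algebra_simps)
    also have "\<bar>\<dots>\<bar> = real x ^ 2 * (1 / v ^ 2 - 1 / u ^ 2)"
      unfolding abs_minus_cancel using inv20 by (intro abs_of_nonneg mult_nonneg_nonneg) auto
    also have "pi * \<dots> \<le> pi * (real X ^ 2 * (16 / u ^ 3))"
      using inv2 inv20 \<open>real x ^ 2 \<le> real X ^ 2\<close> by (intro mult_left_mono mult_mono) auto
    finally show "norm (phase (real x ^ 2 / u ^ 2) - phase (real x ^ 2 / v ^ 2)) \<le>
        pi * (real X ^ 2 * (16 / u ^ 3))" .
  qed
  finally have AA: "norm (A - A') \<le> 16 * pi * real X ^ 3 / u ^ 3"
    by (simp add: power2_eq_square power3_eq_cube mult_ac)
  have A': "norm A' \<le> real X"
    unfolding A'_def by (rule order_trans[OF norm_sum]) simp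
  have "A / of_real u - A' / of_real v = (A - A') / of_real u - A' * of_real (1 / v - 1 / u)"
    by (simp add: algebra_simps diff_divide_distrib)
  also have "norm \<dots> \<le> norm (A - A') / u + norm A' * (1 / v - 1 / u)"
    using u inv0 norm_triangle_ineq4 [of "(A - A') / of_real u" "A' * of_real (1 / v - 1 / u)"]
    by (simp add: norm_divide norm_mult norm_of_real del: of_real_diff of_real_divide)
  also have "\<dots> \<le> 16 * pi * real X ^ 3 / u ^ 3 / u + real X * (4 / u ^ 2)"
    using AA A' inv inv0 u by (intro add_mono divide_right_mono mult_mono) auto
  also have "\<dots> = 16 * pi * real X ^ 3 / u ^ 4 + 4 * real X / u ^ 2"
    by (simp add: eval_nat_numeral mult_ac)
  finally show ?thesis by (simp add: A_def A'_def)
qed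

text \<open>
  With \<open>u\<close> the square root of the larger modulus, the bound is small when \<open>X\<close> is much larger
  than \<open>u\<close> (from the tails) and \<open>X\<^sup>3\<close> is much smaller than \<open>u\<^sup>4\<close> (from the heads).
\<close>

lemma gauss_sum_ratio_diff:
  fixes M M' X :: nat
  defines "u \<equiv> sqrt (real (2 * M))" and "v \<equiv> sqrt (real (2 * M'))"
  assumes "1 \<le> X" "X < M'" "M' \<le> M" "u \<le> v + 2" "u \<le> 2 * v"
  shows "norm (gauss_sum (int (2 * M)) / of_real u - gauss_sum (int (2 * M')) / of_real v)
     \<le> 12 / u + 4 * u / real X + 32 * pi * real X ^ 3 / u ^ 4 + 8 * real X / u ^ 2"
proof -
  define A where "A = (\<Sum>x<X. phase (real x ^ 2 / u ^ 2))"
  define A' where "A' = (\<Sum>x<X. phase (real x ^ 2 / v ^ 2))"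
  have v: "0 < v" "v \<le> u" using assms by (auto simp: u_def v_def)
  then have u: "0 < u" by simp
  have sq: "u ^ 2 = real (2 * M)" "v ^ 2 = real (2 * M')" by (simp_all add: u_def v_def)
  have G: "norm (gauss_sum (int (2 * M)) / of_real u - 2 * A / of_real u) \<le> 4 / u + 2 * u / real X"
  proof -
    have "norm (gauss_sum (int (2 * M)) / of_real u - 2 * A / of_real u) =
        norm (gauss_sum (int (2 * M)) - 2 * A) / u"
      using u by (simp add: diff_divide_distrib[symmetric] norm_divide)
    also have "\<dots> \<le> (4 + 2 * u ^ 2 / real X) / u"
      using gauss_sum_head_bound[of X M] assms u unfolding A_def sq
      by (intro divide_right_mono) auto
    also have "\<dots> = 4 / u + 2 * u / real X"
      using u by (simp add: add_divide_distrib power2_eq_square)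
    finally show ?thesis .
  qed
  have G': "norm (gauss_sum (int (2 * M')) / of_real v - 2 * A' / of_real v) \<le> 8 / u + 2 * u / real X"
  proof -
    have "norm (gauss_sum (int (2 * M')) / of_real v - 2 * A' / of_real v) =
        norm (gauss_sum (int (2 * M')) - 2 * A') / v"
      using v by (simp add: diff_divide_distrib[symmetric] norm_divide)
    also have "\<dots> \<le> (4 + 2 * v ^ 2 / real X) / v"
      using gauss_sum_head_bound[of X M'] assms v unfolding A'_def sq
      by (intro divide_right_mono) auto
    also have "\<dots> = 4 / v + 2 * v / real X"
      using v by (simp add: add_divide_distrib power2_eq_square)
    also have "\<dots> \<le> 8 / u + 2 * u / real X"
    proof (intro add_mono divide_right_mono mult_left_mono)
      show "4 / v \<le> 8 / u" using v u assms by (simp add: field_simps)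
    qed (use v in auto)
    finally show ?thesis .
  qed
  have "norm (A / of_real u - A' / of_real v) \<le> 16 * pi * real X ^ 3 / u ^ 4 + 4 * real X / u ^ 2"
    unfolding A_def A'_def by (rule gauss_head_diff) (use v assms in auto)
  then have AA: "norm (2 * A / of_real u - 2 * A' / of_real v) \<le>
      2 * (16 * pi * real X ^ 3 / u ^ 4 + 4 * real X / u ^ 2)"
    using norm_mult[of 2 "A / of_real u - A' / of_real v"] by (simp add: right_diff_distrib)
  have "norm (gauss_sum (int (2 * M)) / of_real u - gauss_sum (int (2 * M')) / of_real v) =
     norm ((gauss_sum (int (2 * M)) / of_real u - 2 * A / of_real u) +
       (2 * A / of_real u - 2 * A' / of_real v) -
       (gauss_sum (int (2 * M')) / of_real v - 2 * A' / of_real v))" by simp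
  also have "\<dots> \<le> (4 / u + 2 * u / real X) + 2 * (16 * pi * real X ^ 3 / u ^ 4 + 4 * real X / u ^ 2)
      + (8 / u + 2 * u / real X)"
    by (intro norm_triangle_mono order_trans[OF norm_triangle_ineq4] add_mono G G' AA
        order_trans[OF norm_triangle_ineq])
  finally show ?thesis by (simp add: add_divide_distrib)
qed


lemma gauss_sum_2: "gauss_sum 2 = phase (1 / 4) * of_real (sqrt 2)"
proof -
  have "{0..<2::int} = {0, 1}" by auto
  then have "gauss_sum 2 = 1 + phase (1 / 2)" by (simp add: gauss_sum_def)
  then show ?thesis
    by (simp add: phase_def complex_eq_iff cos_45 sin_45)
qed

text \<open>
  Both \<open>N\<close> and 2 are multiplied by squares to reach moduli \<open>N j\<^sup>8\<close> and \<open>2 m\<^sup>2\<close> whose square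
  roots \<open>u\<close> and \<open>v\<close> differ by at most \<open>sqrt 2\<close>. The exponents are chosen so that \<open>u\<close> grows
  like \<open>j\<^sup>4\<close> and the cut-off \<open>X = j\<^sup>5\<close> lies between \<open>u\<close> and \<open>u\<close> to the power
  \<open>4 / 3\<close>; then the comparison of the two normalised sums has an error of order \<open>1 / j\<close>, while
  the normalised sums themselves do not depend on \<open>j\<close>.
\<close>

lemma gauss_sum_eq:
  assumes "even N" "0 < N"
  shows "gauss_sum N = phase (1 / 4) * of_real (sqrt (of_int N))"
proof -
  obtain N' where N': "N = 2 * N'" using \<open>even N\<close> by blast
  define q where "q = nat N'"
  have q: "N = int (2 * q)" "1 \<le> q" using N' \<open>0 < N\<close> by (auto simp: q_def)
  define s where "s = sqrt (of_int N)"
  have s2: "s ^ 2 = 2 * real q" using q by (simp add: s_def)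
  have s: "0 < s" using \<open>0 < N\<close> by (simp add: s_def)
  define C where "C = 12 / s + 4 * s + 32 * pi / s ^ 4 + 8 / s ^ 2"
  define d where "d = norm (gauss_sum N / of_real s - gauss_sum 2 / of_real (sqrt 2))"
  have bound: "d \<le> C / real j" if j: "2 \<le> j" for j :: nat
  proof -
    define u where "u = s * real j ^ 4"
    define m where "m = nat \<lfloor>u / sqrt 2\<rfloor>"
    define v where "v = sqrt 2 * real m"
    have u: "0 < u" using s j by (simp add: u_def)
    have u2: "u ^ 2 = 2 * real (q * j ^ 8)"
      by (simp add: u_def power_mult_distrib s2 power_mult[symmetric])
    have j8: "real j ^ 5 * 8 \<le> real j ^ 8"
    proof -
      have "(2::real) ^ 3 \<le> real j ^ 3" using j by (intro power_mono) auto
      then have "real j ^ 5 * 8 \<le> real j ^ 5 * real j ^ 3" by (intro mult_left_mono) auto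
      then show ?thesis by (simp add: power_add[symmetric])
    qed
    have q_j8: "real j ^ 8 \<le> real (q * j ^ 8)"
      using q mult_right_mono[of 1 "real q" "real j ^ 8"] by simp
    have m: "real m \<le> u / sqrt 2" "u / sqrt 2 < real m + 1"
      using u by (simp_all add: m_def)
    then have v: "v \<le> u" "u < v + sqrt 2" by (simp_all add: v_def field_simps)
    have sqrt2: "sqrt 2 \<le> 2" by (rule real_le_lsqrt) auto
    have "4 \<le> u"
    proof (rule power2_le_imp_le)
      have "(2::real) ^ 8 \<le> real j ^ 8" using j by (intro power_mono) auto
      then show "4 ^ 2 \<le> u ^ 2" unfolding u2 using q_j8 by simp
    qed (use u in simp)
    then have uv: "u \<le> v + 2" "u \<le> 2 * v" using v sqrt2 by linarith+
    then have v0: "0 < v" using u by simp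
    have v2: "v ^ 2 = 2 * real (m ^ 2)" by (simp add: v_def power_mult_distrib)
    have "u ^ 2 \<le> (2 * v) ^ 2" using u uv by (intro power_mono) auto
    then have "real (q * j ^ 8) \<le> 4 * real (m ^ 2)" unfolding u2 power_mult_distrib v2 by simp
    then have "real (j ^ 5) < real (m ^ 2)"
      using j8 q_j8 j zero_less_power[of "real j" 5] unfolding of_nat_power by linarith
    then have jm: "j ^ 5 < m ^ 2" by (simp only: of_nat_less_iff)
    have "v ^ 2 \<le> u ^ 2" using v v0 by (intro power_mono) auto
    then have "real (m ^ 2) \<le> real (q * j ^ 8)" unfolding u2 v2 by simp
    then have mq: "m ^ 2 \<le> q * j ^ 8" by (simp only: of_nat_le_iff)
    have su: "sqrt (real (2 * (q * j ^ 8))) = u" and sv: "sqrt (real (2 * m ^ 2)) = v"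
      using u v0 u2 v2 by (auto intro!: real_sqrt_unique)
    have m0: "0 < m" using v0 by (cases m) (auto simp: v_def)
    have "gauss_sum (int (2 * (q * j ^ 8))) = of_nat j ^ 4 * gauss_sum N"
      using gauss_sum_times_square[of N "int j ^ 4"] assms j q
      by (simp add: power_mult[symmetric] mult_ac)
    then have gu: "gauss_sum (int (2 * (q * j ^ 8))) / of_real u = gauss_sum N / of_real s"
      using j by (simp add: u_def)
    have "gauss_sum (int (2 * m ^ 2)) = of_nat m * gauss_sum 2"
      using gauss_sum_times_square[of 2 "int m"] m0 by (simp add: mult_ac)
    then have gv: "gauss_sum (int (2 * m ^ 2)) / of_real v = gauss_sum 2 / of_real (sqrt 2)"
      using m0 by (simp add: v_def)
    have "d \<le> 12 / u + 4 * u / real (j ^ 5) + 32 * pi * real (j ^ 5) ^ 3 / u ^ 4 + 8 * real (j ^ 5) / u ^ 2"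
      using gauss_sum_ratio_diff[of "j ^ 5" "m ^ 2" "q * j ^ 8"] j jm mq uv
      unfolding su sv gu gv d_def by simp
    also have "\<dots> = 12 / s / real j ^ 4 + 4 * s / real j + 32 * pi / s ^ 4 / real j + 8 / s ^ 2 / real j ^ 3"
      using j s by (simp add: u_def field_simps eval_nat_numeral)
    also have "\<dots> \<le> 12 / s / real j + 4 * s / real j + 32 * pi / s ^ 4 / real j + 8 / s ^ 2 / real j"
      using j s self_le_power[of "real j" 4] self_le_power[of "real j" 3]
      by (intro add_mono divide_left_mono order.refl) auto
    also have "\<dots> = C / real j" by (simp add: C_def add_divide_distrib)
    finally show ?thesis .
  qed
  have "(\<lambda>j. C / real j) \<longlonglongrightarrow> 0" by (rule lim_const_over_n)
  moreover have "eventually (\<lambda>j. d \<le> C / real j) sequentially"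
    using eventually_ge_at_top[of 2] by eventually_elim (rule bound)
  ultimately have "d \<le> 0" by (rule tendsto_lowerbound) simp
  then have "gauss_sum N / of_real s = gauss_sum 2 / of_real (sqrt 2)"
    by (simp add: d_def)
  then show ?thesis using s by (simp add: gauss_sum_2 s_def[symmetric] field_simps)
qed

text \<open>
  The generalised Landsberg--Schaar relation, in the case of an even linear coefficient: Poisson
  summation with the value of \<open>gauss_sum (a * c)\<close> inserted.
\<close>

lemma gauss_sum_reciprocity:
  assumes "0 < a" "0 < c" "even (a * c)"
  shows "(\<Sum>n\<in>{0..<c}. phase ((of_int a * of_int n ^ 2 + 2 * of_int h * of_int n) / of_int c)) =
    phase (1 / 4) * of_real (sqrt (of_int c / of_int a)) *
      (\<Sum>j\<in>{0..<a}. phase (- (of_int (c * j + h) ^ 2 / of_int (a * c))))"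
    (is "?L = phase (1 / 4) * _ * ?R")
proof -
  have "of_int a * ?L = phase (1 / 4) * of_real (sqrt (of_int (a * c))) * ?R"
    using gauss_sum_poisson[OF assms] gauss_sum_eq[of "a * c"] assms by simp
  also have "sqrt (of_int (a * c)) = of_int a * sqrt (of_int c / of_int a)"
    using assms by (simp add: real_sqrt_mult real_sqrt_divide field_simps)
  finally show ?thesis using assms by simp
qed

section \<open>Reciprocity for the form of type A2\<close>

definition a2_form :: "int \<Rightarrow> int \<Rightarrow> int" where
  "a2_form p q = p ^ 2 + p * q + q ^ 2"

text \<open>
  Reciprocity is applied to the sum over \<open>p\<close>, whose square completion leaves the quadratic
  coefficient \<open>d / (2 r)\<close> for \<open>q\<close>, and then to the sum over \<open>q\<close>. The exponent that remains has
  again the \<open>A\<^sub>2\<close> shape.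
\<close>

lemma double_gauss_sum_reciprocity:
  fixes d r :: int
  assumes "0 < d" "0 < r"
  shows "(\<Sum>p\<in>{0..<3 * r}. \<Sum>q\<in>{0..<r}. phase (2 * of_int d * of_int (a2_form p q) / (3 * of_int r))) =
    \<i> * of_real (sqrt 3) * of_int r / of_int d *
      (\<Sum>n\<in>{0..<d}. \<Sum>m\<in>{0..<d}. phase (- (2 * of_int r * of_int (n ^ 2 + m ^ 2 - n * m) / of_int d)))"
proof -
  define f where "f p q = phase (2 * of_int d * of_int (a2_form p q) / (3 * of_int r))" for p q
  define g where "g j m = phase (- (2 * of_int r * of_int (j ^ 2 + m ^ 2 - j * m) / of_int d))" for j m
  define h where "h q j = phase ((of_int d * of_int q ^ 2 + 2 * of_int (- (r * j)) * of_int q) / of_int (2 * r))"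
    for q j
  define T where "T = (\<Sum>p\<in>{0..<3 * r}. \<Sum>q\<in>{0..<r}. f p q)"
  \<comment> \<open>The sum over \<open>p\<close> is \<open>r\<close>-periodic in \<open>q\<close>, but the single terms obtained from reciprocity
    below have period \<open>2 r\<close> in \<open>q\<close>, so two periods are taken.\<close>
  have "2 * T = (\<Sum>q\<in>{0..<2 * r}. \<Sum>p\<in>{0..<3 * r}. f p q)"
  proof -
    define c where "c q = (\<Sum>p\<in>{0..<3 * r}. f p q)" for q
    have "c (q + r) = c q" for q
    proof -
      have "f p (q + r) = f (p + - r) q" for p
        unfolding f_def using assms
        by (intro phase_cong[of _ _ "d * (p + q)"]) 
          (simp add: a2_form_def field_simps power2_eq_square)
      moreover have "f (p + 3 * r) q = f p q" for p
        unfolding f_def using assms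
        by (intro phase_cong[of _ _ "d * (2 * p + q + 3 * r)"])
          (simp add: a2_form_def field_simps power2_eq_square)
      then have "(\<Sum>p\<in>{0..<3 * r}. f (p + - r) q) = (\<Sum>p\<in>{0..<3 * r}. f p q)"
        using assms by (intro sum_periodic_shift) auto
      ultimately show ?thesis by (simp add: c_def)
    qed
    then have "(\<Sum>q\<in>{0..<2 * r}. c q) = of_int 2 * (\<Sum>q\<in>{0..<r}. c q)"
      by (rule sum_periodic_times) (use assms in auto)
    moreover have "(\<Sum>q\<in>{0..<r}. c q) = T"
      unfolding T_def c_def by (rule sum.swap)
    ultimately show ?thesis by (simp add: c_def)
  qed
  also have "\<dots> = (\<Sum>q\<in>{0..<2 * r}. phase (1 / 4) * of_real (sqrt (of_int (3 * r) / of_int (2 * d))) *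
      (\<Sum>j\<in>{0..<2 * d}. phase (- (3 * of_int r * of_int j ^ 2 / (2 * of_int d))) * h q j))"
  proof (intro sum.cong refl)
    fix q
    have "f p q = phase (2 * of_int d * of_int q ^ 2 / (3 * of_int r)) *
        phase ((of_int (2 * d) * of_int p ^ 2 + 2 * of_int (d * q) * of_int p) / of_int (3 * r))" for p
      unfolding f_def phase_add[symmetric] using assms
      by (intro arg_cong[of _ _ phase]) (simp add: a2_form_def field_simps)
    then have "(\<Sum>p\<in>{0..<3 * r}. f p q) = phase (2 * of_int d * of_int q ^ 2 / (3 * of_int r)) *
        (phase (1 / 4) * of_real (sqrt (of_int (3 * r) / of_int (2 * d))) *
        (\<Sum>j\<in>{0..<2 * d}. phase (- (of_int (3 * r * j + d * q) ^ 2 / of_int (2 * d * (3 * r))))))"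
      using assms by (simp only: sum_distrib_left[symmetric]) (subst gauss_sum_reciprocity, auto)
    also have "\<dots> = phase (1 / 4) * of_real (sqrt (of_int (3 * r) / of_int (2 * d))) *
        (\<Sum>j\<in>{0..<2 * d}. phase (2 * of_int d * of_int q ^ 2 / (3 * of_int r)) *
           phase (- (of_int (3 * r * j + d * q) ^ 2 / of_int (2 * d * (3 * r)))))"
      by (simp add: sum_distrib_left mult_ac)
    also have "\<dots> = phase (1 / 4) * of_real (sqrt (of_int (3 * r) / of_int (2 * d))) *
      (\<Sum>j\<in>{0..<2 * d}. phase (- (3 * of_int r * of_int j ^ 2 / (2 * of_int d))) * h q j)"
      unfolding h_def phase_add[symmetric] using assms
      by (intro arg_cong2[of _ _ _ _ "(*)"] refl sum.cong arg_cong[of _ _ phase])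
        (simp add: field_simps power2_eq_square)
    finally show "(\<Sum>p\<in>{0..<3 * r}. f p q) = \<dots>" .
  qed
  also have "\<dots> = phase (1 / 4) * of_real (sqrt (of_int (3 * r) / of_int (2 * d))) *
      (\<Sum>j\<in>{0..<2 * d}. phase (- (3 * of_int r * of_int j ^ 2 / (2 * of_int d))) *
         (\<Sum>q\<in>{0..<2 * r}. h q j))"
    unfolding sum_distrib_left by (rule sum.swap)
  also have "\<dots> = phase (1 / 4) * of_real (sqrt (of_int (3 * r) / of_int (2 * d))) *
      (\<Sum>j\<in>{0..<2 * d}. phase (1 / 4) * of_real (sqrt (of_int (2 * r) / of_int d)) *
         (\<Sum>m\<in>{0..<d}. g j m))"
  proof (rule arg_cong[of _ _ "(*) _"], rule sum.cong[OF refl])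
    fix j
    have "phase (- (3 * of_int r * of_int j ^ 2 / (2 * of_int d))) * (\<Sum>q\<in>{0..<2 * r}. h q j) =
        phase (1 / 4) * of_real (sqrt (of_int (2 * r) / of_int d)) *
         (\<Sum>m\<in>{0..<d}. phase (- (3 * of_int r * of_int j ^ 2 / (2 * of_int d))) *
           phase (- (of_int (2 * r * m + - (r * j)) ^ 2 / of_int (d * (2 * r)))))"
      unfolding h_def using assms
      by (subst gauss_sum_reciprocity) (auto simp: sum_distrib_left mult_ac)
    also have "\<dots> = phase (1 / 4) * of_real (sqrt (of_int (2 * r) / of_int d)) *
         (\<Sum>m\<in>{0..<d}. g j m)"
      unfolding g_def phase_add[symmetric] using assms
      by (intro arg_cong2[of _ _ _ _ "(*)"] refl sum.cong arg_cong[of _ _ phase])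
        (simp add: field_simps power2_eq_square)
    finally show "phase (- (3 * of_int r * of_int j ^ 2 / (2 * of_int d))) * (\<Sum>q\<in>{0..<2 * r}. h q j) =
        phase (1 / 4) * of_real (sqrt (of_int (2 * r) / of_int d)) * (\<Sum>m\<in>{0..<d}. g j m)" .
  qed
  also have "\<dots> = (phase (1 / 4) * phase (1 / 4)) *
      (of_real (sqrt (of_int (3 * r) / of_int (2 * d))) * of_real (sqrt (of_int (2 * r) / of_int d))) *
      (\<Sum>j\<in>{0..<2 * d}. \<Sum>m\<in>{0..<d}. g j m)"
    unfolding sum_distrib_left[symmetric] by (simp only: mult_ac)
  also have "phase (1 / 4) * phase (1 / 4) = \<i>"
    by (simp add: phase_add[symmetric]) (simp add: phase_def complex_eq_iff)
  also have "of_real (sqrt (of_int (3 * r) / of_int (2 * d))) * of_real (sqrt (of_int (2 * r) / of_int d)) =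
      complex_of_real (sqrt 3 * of_int r / of_int d)"
    using assms by (simp add: of_real_mult[symmetric] real_sqrt_mult[symmetric] del: of_real_mult)
      (simp add: real_sqrt_mult real_sqrt_divide)
  also have "(\<Sum>j\<in>{0..<2 * d}. \<Sum>m\<in>{0..<d}. g j m) = of_int 2 * (\<Sum>j\<in>{0..<d}. \<Sum>m\<in>{0..<d}. g j m)"
  proof (rule sum_periodic_times)
    have "g (j + d) m = g j m" for j m
      unfolding g_def using assms
      by (intro phase_cong[of _ _ "- r * (2 * j + d - m)"]) (simp add: field_simps power2_eq_square)
    then show "(\<Sum>m\<in>{0..<d}. g (j + d) m) = (\<Sum>m\<in>{0..<d}. g j m)" for j by simp
  qed (use assms in auto)
  finally have "2 * T = 2 * (\<i> * of_real (sqrt 3 * of_int r / of_int d) * (\<Sum>j\<in>{0..<d}. \<Sum>m\<in>{0..<d}. g j m))"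
    by (simp only: of_int_numeral mult_ac)
  then have "T = \<i> * of_real (sqrt 3 * of_int r / of_int d) * (\<Sum>j\<in>{0..<d}. \<Sum>m\<in>{0..<d}. g j m)"
    by (simp only: mult_cancel_left) simp
  then show ?thesis by (simp add: T_def f_def g_def mult_ac)
qed

section \<open>Unfolding the alcove\<close>

text \<open>
  The lattice points inside the fundamental alcove of the affine Weyl group of type \<open>A\<^sub>2\<close>, with
  \<open>p\<close> and \<open>q\<close> as coordinates in the basis of fundamental weights.
\<close>

definition alcove :: "int \<Rightarrow> (int \<times> int) set" where
  "alcove r = {(p, q). 1 \<le> p \<and> 1 \<le> q \<and> p + q < r}"

lemma finite_alcove: "finite (alcove r)"
  by (rule finite_subset[of _ "{1..r} \<times> {1..r}"]) (auto simp: alcove_def)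

text \<open>
  A square of side \<open>r\<close> consists of a corner, two sides, the antidiagonal and two open triangles,
  each of them a copy of the alcove.
\<close>

lemma sum_square_split:
  fixes f :: "int \<Rightarrow> int \<Rightarrow> 'a::comm_ring_1"
  assumes "0 < r"
  shows "(\<Sum>p\<in>{0..<r}. \<Sum>q\<in>{0..<r}. f p q) =
    f 0 0 + (\<Sum>p\<in>{1..<r}. f p 0) + (\<Sum>q\<in>{1..<r}. f 0 q) + (\<Sum>p\<in>{1..<r}. f p (r - p)) +
    (\<Sum>(p, q)\<in>alcove r. f p q) + (\<Sum>(p, q)\<in>alcove r. f (r - p) (r - q))"
proof -
  define I where "I = {1..<r}"
  define U where "U = (\<lambda>(p, q). (r - p, r - q)) ` alcove r"
  define D where "D = (\<lambda>p. (p, r - p)) ` I"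
  have I: "{0..<r} = insert 0 I" "0 \<notin> I" "finite I" using assms by (auto simp: I_def)
  have "(\<Sum>p\<in>{0..<r}. \<Sum>q\<in>{0..<r}. f p q) =
      f 0 0 + (\<Sum>p\<in>I. f p 0) + (\<Sum>q\<in>I. f 0 q) + (\<Sum>p\<in>I. \<Sum>q\<in>I. f p q)"
    using I by (simp add: sum.distrib)
  also have "(\<Sum>p\<in>I. \<Sum>q\<in>I. f p q) = (\<Sum>(p, q)\<in>I \<times> I. f p q)"
    by (simp add: sum.cartesian_product)
  also have "I \<times> I = D \<union> (alcove r \<union> U)"
  proof (intro equalityI subsetI)
    fix x assume "x \<in> I \<times> I"
    then obtain p q where x: "x = (p, q)" "1 \<le> p" "p < r" "1 \<le> q" "q < r"
      by (auto simp: I_def)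
    consider "p + q = r" | "p + q < r" | "p + q > r" by linarith
    then show "x \<in> D \<union> (alcove r \<union> U)"
    proof cases
      case 1
      then have "x = (p, r - p)" using x by simp
      then have "x \<in> D" using x unfolding D_def I_def by auto
      then show ?thesis by simp
    next
      case 2
      then show ?thesis using x by (auto simp: alcove_def)
    next
      case 3
      then have "(r - p, r - q) \<in> alcove r" using x by (auto simp: alcove_def)
      then have "(\<lambda>(p, q). (r - p, r - q)) (r - p, r - q) \<in> U" unfolding U_def by (rule imageI)
      then show ?thesis using x by simp
    qed
  qed (auto simp: D_def I_def U_def alcove_def)
  also have "(\<Sum>(p, q)\<in>\<dots>. f p q) =
      (\<Sum>(p, q)\<in>D. f p q) + ((\<Sum>(p, q)\<in>alcove r. f p q) + (\<Sum>(p, q)\<in>U. f p q))"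
  proof -
    have "D \<inter> (alcove r \<union> U) = {}" "alcove r \<inter> U = {}"
      by (auto simp: D_def I_def U_def alcove_def)
    moreover have "finite D" "finite U" by (auto simp: D_def U_def I finite_alcove)
    ultimately show ?thesis by (simp add: sum.union_disjoint finite_alcove)
  qed
  also have "(\<Sum>(p, q)\<in>D. f p q) = (\<Sum>p\<in>I. f p (r - p))"
    unfolding D_def by (subst sum.reindex) (auto simp: inj_on_def)
  also have "(\<Sum>(p, q)\<in>U. f p q) = (\<Sum>(p, q)\<in>alcove r. f (r - p) (r - q))"
    unfolding U_def by (subst sum.reindex) (auto simp: inj_on_def case_prod_beta intro!: sum.cong)
  finally show ?thesis by (simp add: I_def algebra_simps)
qed

text \<open>
  The rotation that permutes the three vertices of the alcove cyclically.
\<close>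

lemma sum_alcove_rotate:
  "(\<Sum>(p, q)\<in>alcove r. f p q) = (\<Sum>(p, q)\<in>alcove r. f (r - p - q) p)"
  by (rule sum.reindex_bij_witness[of _ "\<lambda>(p, q). (r - p - q, p)" "\<lambda>(p, q). (q, r - p - q)"])
    (auto simp: alcove_def)

lemma sum_atLeastLessThan_3: "(\<Sum>i\<in>{0..<3::int}. h i) = (h 0 + h 1 + h 2 :: 'a::comm_monoid_add)"
proof -
  have "{0..<3::int} = {0, 1, 2}" by auto
  then show ?thesis by (simp add: add.assoc)
qed

text \<open>
  A function of \<open>a2_form p q\<close> modulo \<open>3 r\<close> is invariant under the affine Weyl group. The strip
  \<open>0 \<le> p < 3 r\<close>, \<open>0 \<le> q < r\<close> is a fundamental domain for the translations, spanned by
  \<open>(2 r, - r)\<close> and \<open>(- r, 2 r)\<close>. Its three squares contain six open triangles with equal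
  sums, its nine wall segments are equivalent, three each, to the bottom sides \<open>B 0\<close>,
  \<open>B 1\<close>, \<open>B 2\<close> of the squares, and the three corners remain. The sum of \<open>F (p\<^sup>2)\<close> runs once
  through the bottom sides and corners, so subtracting it three times removes all walls but
  subtracts each corner twice too often.
\<close>

lemma sum_alcove_unfold:
  fixes F :: "int \<Rightarrow> 'a::comm_ring_1"
  assumes per: "\<And>n t. F (n + 3 * r * t) = F n" and "0 < r"
  shows "6 * (\<Sum>(p, q)\<in>alcove r. F (a2_form p q)) =
    (\<Sum>p\<in>{0..<3 * r}. \<Sum>q\<in>{0..<r}. F (a2_form p q)) - 3 * (\<Sum>p\<in>{0..<3 * r}. F (p ^ 2))
    + 2 * (F 0 + 2 * F (r ^ 2))"
proof -
  have F_cong: "F m = F n" if "m = n + 3 * r * t" for m n t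
    using per that by simp
  define S where "S = (\<Sum>(p, q)\<in>alcove r. F (a2_form p q))"
  define B where "B i = (\<Sum>p\<in>{1..<r}. F ((p + i * r) ^ 2))" for i
  have V2: "F ((2 * r) ^ 2) = F (r ^ 2)"
    by (rule F_cong[of _ _ r]) (simp add: power2_eq_square)
  have lower1: "(\<Sum>(p, q)\<in>alcove r. F (a2_form (p + 1 * r) q)) = S"
  proof -
    have "F (a2_form (p + 1 * r) q) = F (a2_form (r - p - q) p)" for p q
      by (rule F_cong[of _ _ "p + q"]) (simp add: a2_form_def power2_eq_square algebra_simps)
    then show ?thesis unfolding S_def by (subst sum_alcove_rotate) simp
  qed
  have lower2: "(\<Sum>(p, q)\<in>alcove r. F (a2_form (p + 2 * r) q)) = S"
  proof -
    have "F (a2_form (r - p - q + 2 * r) p) = F (a2_form p q)" for p q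
      by (rule F_cong[of _ _ "3 * r - 2 * q - p"]) (simp add: a2_form_def power2_eq_square algebra_simps)
    then show ?thesis unfolding S_def by (subst sum_alcove_rotate) simp
  qed
  have lower0: "(\<Sum>(p, q)\<in>alcove r. F (a2_form (p + 0 * r) q)) = S"
    by (simp add: S_def)
  have upper0: "F (a2_form (r - p + 0 * r) (r - q)) = F (a2_form (p + 0 * r) q)" for p q
    by (rule F_cong[of _ _ "r - p - q"]) (simp add: a2_form_def power2_eq_square algebra_simps)
  have upper1: "F (a2_form (r - p + 1 * r) (r - q)) = F (a2_form (p + 2 * r) q)" for p q
    by (rule F_cong[of _ _ "r - 3 * p - 2 * q"]) (simp add: a2_form_def power2_eq_square algebra_simps)
  have upper2: "F (a2_form (r - p + 2 * r) (r - q)) = F (a2_form (p + 1 * r) q)" for p q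
    by (rule F_cong[of _ _ "4 * r - 3 * p - 2 * q"]) (simp add: a2_form_def power2_eq_square algebra_simps)
  have left1: "F (a2_form (0 + 1 * r) q) = F ((q + 2 * r) ^ 2)" for q
    by (rule F_cong[of _ _ "- q - r"]) (simp add: a2_form_def power2_eq_square algebra_simps)
  have left2: "F (a2_form (0 + 2 * r) q) = F ((q + 1 * r) ^ 2)" for q
    by (rule F_cong[of _ _ r]) (simp add: a2_form_def power2_eq_square algebra_simps)
  have diag0: "F (a2_form (p + 0 * r) (r - p)) = F ((p + 1 * r) ^ 2)" for p
    by (rule F_cong[of _ _ "- p"]) (simp add: a2_form_def power2_eq_square algebra_simps)
  have diag1: "F (a2_form (p + 1 * r) (r - p)) = F ((p + 0 * r) ^ 2)" for p
    by (rule F_cong[of _ _ r]) (simp add: a2_form_def power2_eq_square algebra_simps)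
  have diag2: "F (a2_form (p + 2 * r) (r - p)) = F ((p + 2 * r) ^ 2)" for p
    by (rule F_cong[of _ _ "r - p"]) (simp add: a2_form_def power2_eq_square algebra_simps)
  have bottom: "a2_form x 0 = x ^ 2" "a2_form (0 + 0 * r) x = (x + 0 * r) ^ 2" for x
    by (simp_all add: a2_form_def)
  have "(\<Sum>p\<in>{0..<3 * r}. \<Sum>q\<in>{0..<r}. F (a2_form p q)) =
      (\<Sum>i\<in>{0..<3}. \<Sum>p\<in>{0..<r}. \<Sum>q\<in>{0..<r}. F (a2_form (p + i * r) q))"
    by (rule sum_atLeastLessThan_times) (use \<open>0 < r\<close> in auto)
  also have "\<dots> = (F 0 + F (r ^ 2) + F ((2 * r) ^ 2)) + 3 * (B 0 + B 1 + B 2) + 6 * S"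
    by (simp only: sum_atLeastLessThan_3 sum_square_split[OF \<open>0 < r\<close>] lower0 lower1 lower2
        upper0 upper1 upper2 left1 left2 diag0 diag1 diag2 bottom B_def[symmetric])
      (simp add: algebra_simps)
  finally have T: "(\<Sum>p\<in>{0..<3 * r}. \<Sum>q\<in>{0..<r}. F (a2_form p q)) =
      (F 0 + F (r ^ 2) + F ((2 * r) ^ 2)) + 3 * (B 0 + B 1 + B 2) + 6 * S" .
  have "(\<Sum>p\<in>{0..<3 * r}. F (p ^ 2)) = (\<Sum>i\<in>{0..<3}. \<Sum>p\<in>{0..<r}. F ((p + i * r) ^ 2))"
    by (rule sum_atLeastLessThan_times) (use \<open>0 < r\<close> in auto)
  also have "\<dots> = F 0 + F (r ^ 2) + F ((2 * r) ^ 2) + (B 0 + B 1 + B 2)"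
  proof -
    have "{0..<r} = insert 0 {1..<r}" using \<open>0 < r\<close> by auto
    then show ?thesis unfolding sum_atLeastLessThan_3 B_def by simp
  qed
  finally show ?thesis using T unfolding V2 S_def[symmetric] by (simp add: algebra_simps)
qed

text \<open>
  The unfolded alcove sum with both complete Gauss sums transformed by reciprocity. This is the
  closed form for \<open>b = - d\<close>, with summation over single periods.
\<close>

lemma alcove_phase_sum:
  fixes d r :: int
  assumes "0 < d" "0 < r"
  shows "(\<Sum>(p, q)\<in>alcove r. phase (2 * of_int d * of_int (a2_form p q) / (3 * of_int r))) =
    \<i> * of_real (sqrt 3) * of_int r / (6 * of_int d) *
      (\<Sum>n\<in>{0..<d}. \<Sum>m\<in>{0..<d}. phase (- (2 * of_int r * of_int (n ^ 2 + m ^ 2 - n * m) / of_int d)))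
    - 1 / 2 * (phase (1 / 4) * of_real (sqrt (3 * of_int r / (2 * of_int d)))) *
      (\<Sum>j\<in>{0..<2 * d}. phase (- (3 * of_int r * of_int j ^ 2 / (2 * of_int d))))
    + 1 / 3 + 2 / 3 * phase (2 * of_int r * of_int d / 3)"
proof -
  define F where "F n = phase (2 * of_int d * of_int n / (3 * of_int r))" for n
  have per: "F (n + 3 * r * t) = F n" for n t
    unfolding F_def using assms
    by (intro phase_cong[of _ _ "d * t"]) (simp add: field_simps)
  have G: "(\<Sum>p\<in>{0..<3 * r}. F (p ^ 2)) = phase (1 / 4) * of_real (sqrt (3 * of_int r / (2 * of_int d))) *
      (\<Sum>j\<in>{0..<2 * d}. phase (- (3 * of_int r * of_int j ^ 2 / (2 * of_int d))))"
  proof -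
    have "(3 * of_int r * of_int j) ^ 2 / (2 * of_int d * (3 * of_int r)) =
        (3 * of_int r * of_int j ^ 2 / (2 * of_int d) :: real)" for j
      using assms by (simp add: field_simps power2_eq_square)
    then show ?thesis
      using gauss_sum_reciprocity[of "2 * d" "3 * r" 0] assms by (simp add: F_def)
  qed
  have "F (r ^ 2) = phase (2 * of_int r * of_int d / 3)"
    using assms by (simp add: F_def power2_eq_square field_simps)
  then have "6 * (\<Sum>(p, q)\<in>alcove r. F (a2_form p q)) =
      (\<Sum>p\<in>{0..<3 * r}. \<Sum>q\<in>{0..<r}. F (a2_form p q)) - 3 * (\<Sum>p\<in>{0..<3 * r}. F (p ^ 2))
      + 2 * (1 + 2 * phase (2 * of_int r * of_int d / 3))"
    using sum_alcove_unfold[of F r, OF per \<open>0 < r\<close>] by (simp add: F_def)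
  also have "(\<Sum>p\<in>{0..<3 * r}. \<Sum>q\<in>{0..<r}. F (a2_form p q)) = \<i> * of_real (sqrt 3) * of_int r / of_int d *
      (\<Sum>n\<in>{0..<d}. \<Sum>m\<in>{0..<d}. phase (- (2 * of_int r * of_int (n ^ 2 + m ^ 2 - n * m) / of_int d)))"
    unfolding F_def by (rule double_gauss_sum_reciprocity) fact+
  finally show ?thesis unfolding G by (simp add: F_def field_simps)
qed

section \<open>The invariant as a sum over the alcove\<close>

lemma sum_triangular:
  "2 * (\<Sum>j\<in>{1..n}. int j) = int n * (int n + 1)"
  by (induction n) (simp_all add: algebra_simps)

text \<open>
  Up to normalisation the twist exponent is the Casimir eigenvalue \<open>\<langle>\<lambda> + \<rho>, \<lambda> + \<rho>\<rangle> - \<langle>\<rho>, \<rho>\<rangle>\<close>,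
  and \<open>(p, q)\<close> are the coordinates of \<open>\<lambda> + \<rho>\<close>.
\<close>

lemma twist_exponent_3:
  "twist_exponent 3 [l, m] = 2 * a2_form (int l - int m + 1) (int m + 1) - 6"
proof -
  have cells: "cells [l, m] = Pair 1 ` {1..l} \<union> Pair 2 ` {1..m}"
  proof -
    have "i = 1 \<or> i = 2" if "1 \<le> i" "i \<le> Suc (Suc 0)" for i :: nat using that by auto
    then show ?thesis by (fastforce simp: cells_def)
  qed
  have disj: "Pair (1::nat) ` {1..l} \<inter> Pair 2 ` {1..m} = {}" by auto
  have "card (cells [l, m]) = l + m"
    unfolding cells by (subst card_Un_disjoint) (auto simp: card_image inj_on_def)
  moreover have "(\<Sum>(i, j)\<in>cells [l, m]. int j - int i) =
      (\<Sum>j\<in>{1..l}. int j - 1) + (\<Sum>j\<in>{1..m}. int j - 2)"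
    unfolding cells by (subst sum.union_disjoint) (auto simp: sum.reindex inj_on_def)
  moreover have "2 * \<dots> = int l * (int l + 1) - 2 * int l + int m * (int m + 1) - 4 * int m"
    using sum_triangular[of l] sum_triangular[of m] by (simp add: sum_subtractf algebra_simps)
  ultimately show ?thesis
    unfolding twist_exponent_def a2_form_def by (simp add: power2_eq_square algebra_simps)
qed

lemma skein_a_powi: "skein_a 3 k powi n = phase (- (of_int n / (3 * (of_nat k + 3))))"
proof -
  have *: "- (2 * of_real pi * \<i>) / (2 * of_nat 3 * z) = \<i> * - (of_real pi / (3 * z))" for z :: complex
    by (simp add: field_simps)
  have "skein_a 3 k = cis (- (pi / (3 * (of_nat k + 3))))"
    unfolding skein_a_def cis_conv_exp * by simp
  then show ?thesis by (simp add: phase_def cis_power_int mult.commute)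
qed

lemma Z_twist_torus_3:
  "Z_twist_torus 3 k b = phase (2 * of_int b / (of_nat k + 3)) *
    (\<Sum>(p, q)\<in>alcove (int k + 3). phase (- (2 * of_int b * of_int (a2_form p q) / (3 * (of_nat k + 3)))))"
proof -
  have "Z_twist_torus 3 k b =
      (\<Sum>(p, q)\<in>alcove (int k + 3). skein_a 3 k powi (b * (2 * a2_form p q - 6)))"
    unfolding Z_twist_torus_eq
  proof (rule sum.reindex_bij_witness[of _ "\<lambda>(p, q). [nat (p + q - 2), nat (q - 1)]"
        "\<lambda>l. (int (l ! 0) - int (l ! 1) + 1, int (l ! 1) + 1)"])
    fix l assume "l \<in> young_diagrams 3 k"
    then obtain x y where l: "l = [x, y]" "y \<le> x" "x \<le> k"
      by (auto simp: young_diagrams_def length_Suc_conv numeral_eq_Suc)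
    then show "(case (int (l ! 0) - int (l ! 1) + 1, int (l ! 1) + 1) of
        (p, q) \<Rightarrow> [nat (p + q - 2), nat (q - 1)]) = l" by simp
    show "(int (l ! 0) - int (l ! 1) + 1, int (l ! 1) + 1) \<in> alcove (int k + 3)"
      using l by (simp add: alcove_def)
    show "(case (int (l ! 0) - int (l ! 1) + 1, int (l ! 1) + 1) of
        (p, q) \<Rightarrow> skein_a 3 k powi (b * (2 * a2_form p q - 6))) = skein_a 3 k powi (b * twist_exponent 3 l)"
      using l by (simp add: twist_exponent_3)
  qed (auto simp: alcove_def young_diagrams_def nat_le_eq_zle)
  also have "\<dots> = (\<Sum>(p, q)\<in>alcove (int k + 3). phase (2 * of_int b / (of_nat k + 3)) *
      phase (- (2 * of_int b * of_int (a2_form p q) / (3 * (of_nat k + 3)))))"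
  proof -
    define z where "z = real k + 3"
    have "0 < z" by (simp add: z_def)
    then have "- (of_int (b * (2 * c - 6)) / (3 * z)) = 2 * of_int b / z + - (2 * of_int b * of_int c / (3 * z))" for c
      by (simp add: field_simps)
    then show ?thesis unfolding skein_a_powi phase_add[symmetric] z_def by simp
  qed
  finally show ?thesis by (simp add: sum_distrib_left case_prod_unfold)
qed

section \<open>The closed form\<close>

lemma exp_eq_phase:
  assumes "z = of_real (pi * x) * \<i>"
  shows "exp z = phase x"
  using assms by (simp add: phase_def cis_conv_exp mult.commute)

lemma double_sum_triple_period:
  fixes d r :: int
  assumes "0 < d"
  shows "(\<Sum>n\<in>{0..<3 * d}. \<Sum>m\<in>{0..<3 * d}. phase (2 * of_int r * of_int (n ^ 2 + m ^ 2 - n * m) / of_int d)) =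
    9 * (\<Sum>n\<in>{0..<d}. \<Sum>m\<in>{0..<d}. phase (2 * of_int r * of_int (n ^ 2 + m ^ 2 - n * m) / of_int d))"
proof -
  define g where "g n m = phase (2 * of_int r * of_int (n ^ 2 + m ^ 2 - n * m) / of_int d)" for n m
  have per: "g (n + d) m = g n m" for n m
    unfolding g_def using assms
    by (intro phase_cong[of _ _ "r * (2 * n + d - m)"]) (simp add: field_simps power2_eq_square)
  have sym: "g n m = g m n" for n m by (simp add: g_def algebra_simps)
  have inner: "(\<Sum>m\<in>{0..<3 * d}. g n m) = of_int 3 * (\<Sum>m\<in>{0..<d}. g n m)" for n
    by (rule sum_periodic_times) (use assms sym per in auto)
  have "(\<Sum>n\<in>{0..<3 * d}. \<Sum>m\<in>{0..<d}. g n m) = of_int 3 * (\<Sum>n\<in>{0..<d}. \<Sum>m\<in>{0..<d}. g n m)"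
    by (rule sum_periodic_times) (use assms per in auto)
  then show ?thesis using inner by (simp add: g_def sum_distrib_left[symmetric])
qed

theorem theorem4p1p1:
  fixes k :: nat and b :: int and r :: real
  assumes "b \<noteq> 0" and "r = real k + 3"
  shows "Z_twist_torus 3 k b =
    exp (2 * of_real pi * \<i> * of_int b / of_real r) *
      (- (of_real (sqrt 3) * \<i> / (54 * of_int b)) * of_real r *
         (\<Sum>n = 0..3 * \<bar>b\<bar> - 1. \<Sum>m = 0..3 * \<bar>b\<bar> - 1.
            exp (2 * of_real pi * \<i> * of_real r * of_int (n\<^sup>2 + m\<^sup>2 - n * m) / of_int b))
       - 1 / 2 * csqrt (3 / (2 * of_int b)) * exp (- (of_real pi * \<i>) / 4) * of_real (sqrt r) *
         (\<Sum>n = 0..2 * \<bar>b\<bar> - 1.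
            exp (of_real pi * \<i> * of_real r * (3 * of_int (n\<^sup>2) / (2 * of_int b))))
       + 1 / 3 + 2 / 3 * exp (- (2 * of_real pi * \<i> * of_real r * of_int b / 3)))"
proof -
  define R d where "R = int k + 3" and "d = \<bar>b\<bar>"
  have R: "r = of_int R" "0 < R" and d: "0 < d" using assms by (auto simp: R_def d_def)
  define D where "D s = (\<Sum>n\<in>{0..<d}. \<Sum>m\<in>{0..<d}.
     phase (s * (2 * of_int R * of_int (n ^ 2 + m ^ 2 - n * m) / of_int d)))" for s
  define G where "G s = (\<Sum>j\<in>{0..<2 * d}. phase (s * (3 * of_int R * of_int j ^ 2 / (2 * of_int d))))" for s
  define S where "S s = (\<Sum>(p, q)\<in>alcove R. phase (s * (2 * of_int d * of_int (a2_form p q) / (3 * of_int R))))" for s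
  have Z: "Z_twist_torus 3 k b = exp (2 * of_real pi * \<i> * of_int b / of_real r) * S (- of_int (sgn b))"
  proof -
    have "exp (2 * of_real pi * \<i> * of_int b / of_real r) = phase (2 * of_int b / (of_nat k + 3))"
      by (rule exp_eq_phase) (simp add: assms(2))
    moreover have "b = sgn b * d" by (simp add: d_def sgn_mult_abs)
    then have "real_of_int b = of_int (sgn b) * of_int d" by (metis of_int_mult)
    ultimately show ?thesis unfolding Z_twist_torus_3 S_def by (simp add: R_def mult_ac)
  qed
  have S1: "S 1 = \<i> * of_real (sqrt 3) * of_int R / (6 * of_int d) * D (- 1)
      - 1 / 2 * (phase (1 / 4) * of_real (sqrt (3 / (2 * of_int d)) * sqrt r)) * G (- 1)
      + 1 / 3 + 2 / 3 * phase (2 * of_int R * of_int d / 3)"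
  proof -
    have "sqrt (3 * of_int R / (2 * of_int d)) = sqrt (3 / (2 * of_int d)) * sqrt r"
      using R by (simp add: real_sqrt_mult[symmetric])
    then show ?thesis
      using alcove_phase_sum[OF d R(2)] by (simp add: S_def D_def G_def)
  qed
  \<comment> \<open>Changing the sign of \<open>b\<close> conjugates every sum, so the case of positive \<open>b\<close> follows from the
    evaluation for negative \<open>b\<close>.\<close>
  have cnjS: "S (- 1) = cnj (S 1)" and cnjD: "D 1 = cnj (D (- 1))" and cnjG: "G 1 = cnj (G (- 1))"
    by (simp_all add: S_def D_def G_def cnj_sum cnj_phase case_prod_unfold)
  have int1: "{0..3 * \<bar>b\<bar> - 1} = {0..<3 * d}" "{0..2 * \<bar>b\<bar> - 1} = {0..<2 * d}"
    by (auto simp: d_def)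
  have e4: "exp (- (of_real pi * \<i>) / 4) = phase (- (1 / 4))"
    by (rule exp_eq_phase) simp
  have e3: "exp (- (2 * of_real pi * \<i> * of_real r * of_int b / 3)) = phase (- (2 * of_int R * of_int b / 3))"
    by (rule exp_eq_phase) (simp add: R)
  have eD: "exp (2 * of_real pi * \<i> * of_real r * of_int (n\<^sup>2 + m\<^sup>2 - n * m) / of_int b) =
      phase (2 * of_int R * of_int (n ^ 2 + m ^ 2 - n * m) / of_int b)" for n m
    by (rule exp_eq_phase) (simp add: R)
  have eG: "exp (of_real pi * \<i> * of_real r * (3 * of_int (n\<^sup>2) / (2 * of_int b))) =
      phase (3 * of_int R * of_int n ^ 2 / (2 * of_int b))" for n
    by (rule exp_eq_phase) (simp add: R)
  show ?thesis
  proof (cases "0 < b")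
    case True
    then have b: "b = d" "sgn b = 1" by (simp_all add: d_def)
    have DD: "(\<Sum>n\<in>{0..<3 * d}. \<Sum>m\<in>{0..<3 * d}.
        phase (2 * of_int R * of_int (n ^ 2 + m ^ 2 - n * m) / of_int b)) = 9 * D 1"
      using double_sum_triple_period[OF d, of R] by (simp add: b D_def)
    have GG: "(\<Sum>n\<in>{0..<2 * d}. phase (3 * of_int R * of_int n ^ 2 / (2 * of_int b))) = G 1"
      by (simp add: b G_def)
    have cs: "csqrt (3 / (2 * of_int b)) = of_real (sqrt (3 / (2 * of_int d)))"
      using csqrt_of_real_nonneg[of "3 / (2 * of_int d)"] d by (simp add: b)
    show ?thesis
      unfolding Z int1 e4 e3 eD eG DD GG cs b(2)
      using d by (simp add: cnjS cnjD cnjG S1 cnj_phase R b field_simps)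
  next
    case False
    then have b: "b = - d" "sgn b = - 1" using assms(1) by (simp_all add: d_def)
    have DD: "(\<Sum>n\<in>{0..<3 * d}. \<Sum>m\<in>{0..<3 * d}.
        phase (2 * of_int R * of_int (n ^ 2 + m ^ 2 - n * m) / of_int b)) = 9 * D (- 1)"
      using double_sum_triple_period[OF d, of "- R"] by (simp add: b D_def)
    have GG: "(\<Sum>n\<in>{0..<2 * d}. phase (3 * of_int R * of_int n ^ 2 / (2 * of_int b))) = G (- 1)"
      by (simp add: b G_def)
    \<comment> \<open>For negative \<open>b\<close> the principal square root is on the positive imaginary axis, which turns
      the factor \<open>exp (- \<pi> \<i> / 4)\<close> into its conjugate.\<close>
    have cs: "csqrt (3 / (2 * of_int b)) = \<i> * of_real (sqrt (3 / (2 * of_int d)))"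
      using csqrt_of_real_nonpos[of "- (3 / (2 * of_int d))"] d by (simp add: b)
    have i: "\<i> * phase (- (1 / 4)) = phase (1 / 4)"
    proof -
      have "\<i> = phase (1 / 2)" by (simp add: phase_def complex_eq_iff)
      moreover have "phase (1 / 2) * phase (- (1 / 4)) = phase (1 / 4)"
        unfolding phase_add[symmetric] by simp
      ultimately show ?thesis by (simp only:)
    qed
    have "csqrt (3 / (2 * of_int b)) * phase (- (1 / 4)) = phase (1 / 4) * of_real (sqrt (3 / (2 * of_int d)))"
      unfolding cs i[symmetric] by (simp add: mult_ac)
    note cs' = this
    show ?thesis
      unfolding Z int1 e4 e3 eD eG DD GG b(2) mult.assoc[of "1 / 2"] cs'
      using d by (simp add: S1 R b field_simps)
  qed
qed

end
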